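(* Let $L\in\mathbb{R}^{n\times n}$ be irreducible with zero column sums, spectral abscissa $0$ with $0$ a simple eigenvalue, and eventually exponentially positive. Let $r_{02}(z)=\dfrac{1}{1-z+z^2/2}$. Then there exists $\gamma_r\in[0,\infty)$ such that $$r_{02}(\gamma L)=\Bigl(\mathcal I-\gamma L+\tfrac{\gamma^2}{2}L^2\Bigr)^{-1}>0\qquad\text{for all }\gamma\ge\gamma_r,\ \gamma>0,$$ and, if $L$ has a negative off-diagonal entry, then $r_{02}(\gamma L)$ has a negative entry for all sufficiently small $\gamma>0$, so that every such $\gamma_r$ satisfies $\gamma_r>0$.
   Context: $\mathcal I$ is the identity matrix. Matrix inequalities are entrywise: $M>0$ means every entry of $M$ is strictly positive. $L$ is eventually exponentially positive if there is $\tau_0\ge0$ such that $e^{tL}>0$ for all $t\ge\tau_0$. The spectral abscissa is the maximal real part of the eigenvalues. *)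

theory Defs
  imports
    "HOL-Analysis.Analysis"
    "Jordan_Normal_Form.Spectral_Radius"
    "Jordan_Normal_Form.Gauss_Jordan_Elimination"
begin

definition mat_pos :: "real mat \<Rightarrow> bool" where
  "mat_pos A \<longleftrightarrow> (\<forall>i<dim_row A. \<forall>j<dim_col A. 0 < A $$ (i,j))"

definition mat_has_neg_entry :: "real mat \<Rightarrow> bool" where
  "mat_has_neg_entry A \<longleftrightarrow> (\<exists>i<dim_row A. \<exists>j<dim_col A. A $$ (i,j) < 0)"

(* For a square matrix every entry series converges: see summable_mat_exp. *)
definition mat_exp :: "real mat \<Rightarrow> real mat" where
  "mat_exp A = mat (dim_row A) (dim_row A) (\<lambda>(i,j). \<Sum>k. (A ^\<^sub>m k) $$ (i,j) / fact k)"

definition eventually_exp_pos :: "real mat \<Rightarrow> bool" where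
  "eventually_exp_pos L \<longleftrightarrow> (\<exists>\<tau>\<^sub>0\<ge>0. \<forall>t\<ge>\<tau>\<^sub>0. mat_pos (mat_exp (t \<cdot>\<^sub>m L)))"

(* Reducible: some simultaneous permutation of rows and columns is block upper triangular,
   with square diagonal blocks of sizes r and n - r, both nonempty.
   In particular every 1 x 1 matrix is irreducible. *)
definition reducible_mat :: "real mat \<Rightarrow> bool" where
  "reducible_mat A \<longleftrightarrow> (\<exists>p r. p permutes {..<dim_row A} \<and> 0 < r \<and> r < dim_row A \<and>
     (\<forall>i j. r \<le> i \<and> i < dim_row A \<and> j < r \<longrightarrow> A $$ (p i, p j) = 0))"

definition irreducible_mat :: "real mat \<Rightarrow> bool" where
  "irreducible_mat A \<longleftrightarrow> \<not> reducible_mat A"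

definition zero_col_sums :: "real mat \<Rightarrow> bool" where
  "zero_col_sums A \<longleftrightarrow> (\<forall>j<dim_col A. (\<Sum>i<dim_row A. A $$ (i,j)) = 0)"

(* The complex eigenvalues are meant, hence the coercion of the entries. *)
definition spectral_abscissa :: "real mat \<Rightarrow> real" where
  "spectral_abscissa A = Max (Re ` spectrum (map_mat complex_of_real A))"

(* Simple means of algebraic multiplicity one. *)
definition simple_eigenvalue :: "'a::field mat \<Rightarrow> 'a \<Rightarrow> bool" where
  "simple_eigenvalue A k \<longleftrightarrow> eigenvalue A k \<and> order k (char_poly A) = 1"

(* The denominator 1 - z + z^2/2 evaluated at a square matrix. *)
definition r02_denom :: "real mat \<Rightarrow> real mat" where
  "r02_denom Z = 1\<^sub>m (dim_row Z) - Z + (1/2) \<cdot>\<^sub>m (Z ^\<^sub>m 2)"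

(* Meaningful only if the denominator is invertible; mat_inverse returns None otherwise. *)
definition r02 :: "real mat \<Rightarrow> real mat" where
  "r02 Z = the (mat_inverse (r02_denom Z))"

(* The equation with Some asserts that the inverse exists and equals r02 (\<gamma> L). *)
definition r02_pos_from :: "real mat \<Rightarrow> real \<Rightarrow> bool" where
  "r02_pos_from L \<gamma>\<^sub>r \<longleftrightarrow> (\<forall>\<gamma>. \<gamma> \<ge> \<gamma>\<^sub>r \<and> \<gamma> > 0 \<longrightarrow>
     mat_inverse (1\<^sub>m (dim_row L) - \<gamma> \<cdot>\<^sub>m L + (\<gamma>^2/2) \<cdot>\<^sub>m (L ^\<^sub>m 2)) = Some (r02 (\<gamma> \<cdot>\<^sub>m L)) \<and>
     mat_pos (r02 (\<gamma> \<cdot>\<^sub>m L)))"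

lemma summable_mat_exp:
  fixes A :: "real mat"
  assumes A: "A \<in> carrier_mat n n" and ij: "i < n" "j < n"
  shows "summable (\<lambda>k. (A ^\<^sub>m k) $$ (i,j) / fact k)"
proof -
  define c where "c = (\<Sum>i<n. \<Sum>j<n. \<bar>A $$ (i,j)\<bar>)"
  have c: "\<bar>A $$ (i,j)\<bar> \<le> c" if "i < n" "j < n" for i j
  proof -
    have "\<bar>A $$ (i,j)\<bar> \<le> (\<Sum>j<n. \<bar>A $$ (i,j)\<bar>)"
      using that by (intro member_le_sum) auto
    also have "\<dots> \<le> c" unfolding c_def
      using that by (intro member_le_sum[of i _ "\<lambda>i. \<Sum>j<n. \<bar>A $$ (i,j)\<bar>"]) (auto intro: sum_nonneg)
    finally show ?thesis .
  qed
  have c0: "0 \<le> c" unfolding c_def by (intro sum_nonneg) auto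
  have bound: "\<bar>(A ^\<^sub>m k) $$ (i,j)\<bar> \<le> (real n * c) ^ k" if "i < n" "j < n" for i j k
    using that
  proof (induction k arbitrary: i j)
    case 0
    then show ?case using A by auto
  next
    case (Suc k)
    have Ak: "A ^\<^sub>m k \<in> carrier_mat n n" using A by (rule pow_carrier_mat)
    have "(A ^\<^sub>m Suc k) $$ (i,j) = (\<Sum>l<n. (A ^\<^sub>m k) $$ (i,l) * A $$ (l,j))"
      using Suc.prems A Ak by (simp add: scalar_prod_def atLeast0LessThan)
    also have "\<bar>\<dots>\<bar> \<le> (\<Sum>l<n. (real n * c) ^ k * c)"
      using Suc c c0
      by (intro order_trans[OF sum_abs] sum_mono) (auto simp: abs_mult intro!: mult_mono)
    also have "\<dots> = (real n * c) ^ Suc k" by (simp add: algebra_simps)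
    finally show ?case .
  qed
  have "summable (\<lambda>k. (real n * c) ^ k / fact k)"
    using summable_exp_generic[of "real n * c"] by (simp add: divide_inverse mult.commute)
  then show ?thesis
    by (rule summable_comparison_test'[where N = 0])
       (use bound ij in \<open>auto intro!: divide_right_mono\<close>)
qed

end

(* Zero column sums give 1^T L = 0, so P = exp(tL) is, for a suitable t, a positive column-stochastic
   matrix fixing every kernel vector of L. Hence the kernel is spanned by a positive vector w with
   entry sum 1 and contains no nonzero vector of entry sum 0. Put J = w 1^T and
   D = I - gL + g^2 L^2 / 2. Then (D / g^2 + (1/2 - 1/g) J) (D^-1 - J) = (I - J) / g^2, and the first
   factor tends to the nonsingular matrix (L^2 + J) / 2 as g tends to infinity, so D^-1 tends to J > 0.
   For small g, D^-1 = I + g (L - (g/2) L^2) D^-1 gives (D^-1)_ij / g -> L_ij off the diagonal. *)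
theory Submission
  imports Defs
begin

section \<open>Entrywise limits of determinants, adjugates and solutions of matrix equations\<close>

lemma index_mult_mat_sum:
  assumes "A \<in> carrier_mat n n" "B \<in> carrier_mat n n" "i < n" "j < n"
  shows "(A * B) $$ (i,j) = (\<Sum>l<n. A $$ (i,l) * B $$ (l,j))"
  using assms by (simp add: scalar_prod_def atLeast0LessThan)

lemma index_mult_mat_vec_sum:
  assumes "A \<in> carrier_mat n n" "x \<in> carrier_vec n" "i < n"
  shows "vec_index (A *\<^sub>v x) i = (\<Sum>l<n. A $$ (i,l) * vec_index x l)"
  using assms by (simp add: scalar_prod_def atLeast0LessThan)

text \<open>By the Leibniz formula the determinant is a polynomial in the entries, so entrywise
  convergence is enough.\<close>

lemma tendsto_det:
  fixes A :: "'b \<Rightarrow> 'a::real_normed_field mat"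
  assumes A: "\<And>t. A t \<in> carrier_mat n n" and A0: "A0 \<in> carrier_mat n n"
    and lim: "\<And>i j. i < n \<Longrightarrow> j < n \<Longrightarrow> ((\<lambda>t. A t $$ (i,j)) \<longlongrightarrow> A0 $$ (i,j)) F"
  shows "((\<lambda>t. det (A t)) \<longlongrightarrow> det A0) F"
  unfolding det_def'[OF A] det_def'[OF A0]
  by (intro tendsto_intros lim) (auto dest: permutes_in_image)

text \<open>Each entry of the adjugate is a signed determinant of a submatrix, so
  \<open>tendsto_det\<close> applies to it.\<close>

lemma tendsto_adj_mat:
  fixes A :: "'b \<Rightarrow> 'a::real_normed_field mat"
  assumes A: "\<And>t. A t \<in> carrier_mat n n" and A0: "A0 \<in> carrier_mat n n"
    and lim: "\<And>i j. i < n \<Longrightarrow> j < n \<Longrightarrow> ((\<lambda>t. A t $$ (i,j)) \<longlongrightarrow> A0 $$ (i,j)) F"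
    and ij: "i < n" "j < n"
  shows "((\<lambda>t. adj_mat (A t) $$ (i,j)) \<longlongrightarrow> adj_mat A0 $$ (i,j)) F"
proof -
  have dims: "dim_row (A t) = n" "dim_col (A t) = n" "dim_row A0 = n" "dim_col A0 = n" for t
    using A[of t] A0 by auto
  have "((\<lambda>t. det (mat_delete (A t) j i)) \<longlongrightarrow> det (mat_delete A0 j i)) F"
    using mat_delete_carrier[OF A] mat_delete_carrier[OF A0] ij
    by (intro tendsto_det) (auto simp: mat_delete_def dims intro!: lim)
  then show ?thesis
    using ij by (auto simp: adj_mat_def cofactor_def dims intro!: tendsto_intros)
qed

text \<open>Multiplying by the adjugate gives \<open>det (A t) \<cdot> X t = adj (A t) \<cdot> C t\<close>, whose right-hand side converges.\<close>

lemma tendsto_mat_solution: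
  fixes A X C :: "'b \<Rightarrow> 'a::real_normed_field mat"
  assumes A: "\<And>t. A t \<in> carrier_mat n n" and A0: "A0 \<in> carrier_mat n n"
    and X: "\<And>t. X t \<in> carrier_mat n n" and X0: "X0 \<in> carrier_mat n n"
    and limA: "\<And>i j. i < n \<Longrightarrow> j < n \<Longrightarrow> ((\<lambda>t. A t $$ (i,j)) \<longlongrightarrow> A0 $$ (i,j)) F"
    and limC: "\<And>i j. i < n \<Longrightarrow> j < n \<Longrightarrow> ((\<lambda>t. (A t * X t) $$ (i,j)) \<longlongrightarrow> (A0 * X0) $$ (i,j)) F"
    and det0: "det A0 \<noteq> 0" and ij: "i < n" "j < n"
  shows "((\<lambda>t. X t $$ (i,j)) \<longlongrightarrow> X0 $$ (i,j)) F"
proof -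
  \<comment> \<open>Cramer's rule without division, stated for arbitrary \<open>B\<close> and
    \<open>Y\<close> because it serves both along the filter and at the limit.\<close>
  have adj: "(\<Sum>l<n. adj_mat B $$ (i,l) * (B * Y) $$ (l,j)) = det B * Y $$ (i,j)"
    if "B \<in> carrier_mat n n" "Y \<in> carrier_mat n n" for B Y :: "'a mat"
  proof -
    have "adj_mat B * (B * Y) = (det B \<cdot>\<^sub>m 1\<^sub>m n) * Y"
      using that adj_mat[OF that(1)] by (simp flip: assoc_mult_mat)
    also have "\<dots> = det B \<cdot>\<^sub>m Y"
      using that by (simp add: mult_smult_assoc_mat[of _ n n])
    finally have "(adj_mat B * (B * Y)) $$ (i,j) = det B * Y $$ (i,j)" using that ij by simp
    then show ?thesis
      using that ij adj_mat[OF that(1)] mult_carrier_mat[OF that]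
      by (simp add: index_mult_mat_sum del: index_mult_mat)
  qed
  have lim_det: "((\<lambda>t. det (A t)) \<longlongrightarrow> det A0) F"
    by (rule tendsto_det[OF A A0 limA])
  have "((\<lambda>t. (\<Sum>l<n. adj_mat (A t) $$ (i,l) * (A t * X t) $$ (l,j)) / det (A t)) \<longlongrightarrow>
      (\<Sum>l<n. adj_mat A0 $$ (i,l) * (A0 * X0) $$ (l,j)) / det A0) F"
    using det0 ij by (intro tendsto_intros lim_det tendsto_adj_mat[OF A A0 limA] limC) auto
  then have "((\<lambda>t. det (A t) * X t $$ (i,j) / det (A t)) \<longlongrightarrow> X0 $$ (i,j)) F"
    using det0 by (simp add: adj A A0 X X0 del: index_mult_mat)
  \<comment> \<open>\<open>A t\<close> may be singular for some \<open>t\<close>; cancelling its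
    determinant is allowed only eventually.\<close>
  moreover have "\<forall>\<^sub>F t in F. det (A t) \<noteq> 0"
    using lim_det det0 by (rule tendsto_imp_eventually_ne)
  ultimately show ?thesis
    by (elim Lim_transform_eventually) (auto elim: eventually_mono)
qed

section \<open>Positive stochastic matrices, and the exponential of a matrix with zero column
  sums\<close>

text \<open>The positive part of \<open>x\<close> satisfies \<open>x\<^sup>+ \<le> P x\<^sup>+\<close>; as \<open>P\<close> preserves the total sum, equality holds
  and the positivity of \<open>P\<close> spreads to all entries.\<close>

lemma stochastic_fixed_vector_pos:
  fixes P :: "nat \<Rightarrow> nat \<Rightarrow> real" and x :: "nat \<Rightarrow> real"
  assumes pos: "\<And>i j. i < n \<Longrightarrow> j < n \<Longrightarrow> P i j > 0"
    and col: "\<And>j. j < n \<Longrightarrow> (\<Sum>i<n. P i j) = 1"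
    and fixpt: "\<And>i. i < n \<Longrightarrow> (\<Sum>j<n. P i j * x j) = x i"
    and a: "a < n" "x a > 0" and i: "i < n"
  shows "x i > 0"
proof -
  define p where "p i = max (x i) 0" for i
  have p0: "p i \<ge> 0" for i by (simp add: p_def)
  have le: "p i \<le> (\<Sum>j<n. P i j * p j)" if "i < n" for i
  proof -
    have "x i \<le> (\<Sum>j<n. P i j * p j)"
      unfolding fixpt[OF that, symmetric]
      using pos that by (intro sum_mono mult_left_mono) (auto simp: p_def less_imp_le)
    moreover have "0 \<le> (\<Sum>j<n. P i j * p j)"
      using pos that p0 by (intro sum_nonneg mult_nonneg_nonneg) (auto simp: less_imp_le)
    ultimately show ?thesis by (simp add: p_def)
  qed
  have "(\<Sum>i<n. \<Sum>j<n. P i j * p j) = (\<Sum>i<n. p i)"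
    by (subst sum.swap) (simp add: col flip: sum_distrib_right)
  \<comment> \<open>By \<open>le\<close> all these differences are nonnegative, so a vanishing total
    makes each of them zero.\<close>
  then have "(\<Sum>i<n. (\<Sum>j<n. P i j * p j) - p i) = 0"
    by (simp add: sum_subtractf)
  then have eq: "(\<Sum>j<n. P i j * p j) = p i"
    using i le by (subst (asm) sum_nonneg_eq_0_iff) auto
  \<comment> \<open>A single summand already makes \<open>p i\<close> positive, and a positive
    \<open>p i\<close> can only be \<open>x i\<close> itself.\<close>
  have "0 < P i a * p a" using pos a i by (simp add: p_def)
  also have "\<dots> \<le> (\<Sum>j<n. P i j * p j)"
    using a i pos p0
    by (intro member_le_sum[of a _ "\<lambda>j. P i j * p j"]) (auto simp: less_imp_le)
  finally show ?thesis using eq by (simp add: p_def max_def split: if_splits)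
qed

text \<open>The row vector of ones is annihilated by \<open>A\<close>, hence by every positive
  power; the zeroth power is the identity.\<close>

lemma zero_col_sums_pow:
  assumes A: "A \<in> carrier_mat n n" and z: "zero_col_sums A" and j: "j < n"
  shows "(\<Sum>i<n. (A ^\<^sub>m k) $$ (i,j)) = (if k = 0 then 1 else 0)"
proof (cases k)
  case 0
  then show ?thesis using A j by (simp add: if_distrib sum.delta cong: if_cong)
next
  case (Suc m)
  have "(\<Sum>i<n. (A ^\<^sub>m Suc m) $$ (i,j)) = 0" using j
  proof (induction m arbitrary: j)
    case 0
    then show ?case using z A by (simp add: zero_col_sums_def left_mult_one_mat[of A n n])
  next
    case (Suc m)
    have c: "A ^\<^sub>m Suc m \<in> carrier_mat n n" using A by (rule pow_carrier_mat)
    have "(\<Sum>i<n. (A ^\<^sub>m Suc (Suc m)) $$ (i,j)) = (\<Sum>i<n. \<Sum>l<n. (A ^\<^sub>m Suc m) $$ (i,l) * A $$ (l,j))"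
      using index_mult_mat_sum[OF c A _ Suc.prems] by simp
    also have "\<dots> = (\<Sum>l<n. (\<Sum>i<n. (A ^\<^sub>m Suc m) $$ (i,l)) * A $$ (l,j))"
      by (subst sum.swap) (simp add: sum_distrib_right)
    also have "\<dots> = 0" using Suc.IH by simp
    finally show ?case .
  qed
  then show ?thesis using Suc by simp
qed

text \<open>Serves the two exponential series below in which only the term \<open>k = 0\<close>
  survives.\<close>

lemma suminf_exp_series_0: "(\<Sum>k. (if k = 0 then c else 0) / fact k) = (c::real)"
proof -
  have "(\<lambda>k. (if k = 0 then c else 0) / fact k :: real) = (\<lambda>k. if k = 0 then c else 0)" by auto
  then show ?thesis using sums_single[of 0 "\<lambda>_. c"] by (simp add: sums_iff)
qed

text \<open>Multiplying the series by the row vector of ones from the left leaves only the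
  contribution of the identity.\<close>

lemma zero_col_sums_mat_exp:
  assumes A: "A \<in> carrier_mat n n" and z: "zero_col_sums A" and j: "j < n"
  shows "(\<Sum>i<n. mat_exp A $$ (i,j)) = 1"
proof -
  have "(\<Sum>i<n. mat_exp A $$ (i,j)) = (\<Sum>i<n. \<Sum>k. (A ^\<^sub>m k) $$ (i,j) / fact k)"
    using A j by (simp add: mat_exp_def)
  also have "\<dots> = (\<Sum>k. \<Sum>i<n. (A ^\<^sub>m k) $$ (i,j) / fact k)"
    using A j by (intro suminf_sum[symmetric] summable_mat_exp[of _ n]) auto
  also have "\<dots> = 1"
    by (simp only: zero_col_sums_pow[OF A z j] suminf_exp_series_0 flip: sum_divide_distrib)
  finally show ?thesis .
qed

text \<open>All positive powers of \<open>A\<close> annihilate \<open>x\<close>, so only the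
  identity term of the series acts on it.\<close>

lemma mat_exp_kernel:
  assumes A: "A \<in> carrier_mat n n" and x: "x \<in> carrier_vec n" and Ax: "A *\<^sub>v x = 0\<^sub>v n" and i: "i < n"
  shows "(\<Sum>j<n. mat_exp A $$ (i,j) * vec_index x j) = vec_index x i"
proof -
  have pow: "(\<Sum>j<n. (A ^\<^sub>m k) $$ (i,j) * vec_index x j) = (if k = 0 then vec_index x i else 0)" for k
  proof -
    have "A ^\<^sub>m k *\<^sub>v x = (if k = 0 then x else 0\<^sub>v n)"
    proof (cases k)
      case (Suc m)
      have "A ^\<^sub>m m *\<^sub>v 0\<^sub>v n = 0\<^sub>v n"
        using pow_carrier_mat[OF A, of m] by (intro eq_vecI) (auto simp: scalar_prod_def)
      then show ?thesis
        using assoc_mult_mat_vec[OF pow_carrier_mat[OF A] A x, of m] Ax Suc by simp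
    qed (use A x in auto)
    then show ?thesis
      using index_mult_mat_vec_sum[OF pow_carrier_mat[OF A] x i, of k] i by (simp split: if_splits)
  qed
  have "(\<Sum>j<n. mat_exp A $$ (i,j) * vec_index x j)
      = (\<Sum>j<n. \<Sum>k. (A ^\<^sub>m k) $$ (i,j) / fact k * vec_index x j)"
    using A i by (simp add: mat_exp_def suminf_mult2 summable_mat_exp)
  also have "\<dots> = (\<Sum>k. \<Sum>j<n. (A ^\<^sub>m k) $$ (i,j) / fact k * vec_index x j)"
    using A i by (intro suminf_sum[symmetric] summable_mult2 summable_mat_exp[of _ n]) auto
  also have "\<dots> = (\<Sum>k. (\<Sum>j<n. (A ^\<^sub>m k) $$ (i,j) * vec_index x j) / fact k)"
    by (simp add: sum_divide_distrib)
  also have "\<dots> = vec_index x i"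
    by (simp only: pow suminf_exp_series_0)
  finally show ?thesis .
qed

section \<open>The denominator and its invertibility\<close>

lemma r02_denom_smult:
  assumes "L \<in> carrier_mat n n"
  shows "r02_denom (\<gamma> \<cdot>\<^sub>m L) = 1\<^sub>m n - \<gamma> \<cdot>\<^sub>m L + (\<gamma>\<^sup>2 / 2) \<cdot>\<^sub>m (L ^\<^sub>m 2)"
  using assms
  by (auto simp: r02_denom_def numeral_2_eq_2 power2_eq_square left_mult_one_mat[of _ n n]
      mult_smult_distrib[of _ n n] mult_smult_assoc_mat[of _ n n] intro!: eq_matI)

lemma r02_denom_carrier:
  assumes "L \<in> carrier_mat n n"
  shows "r02_denom (\<gamma> \<cdot>\<^sub>m L) \<in> carrier_mat n n"
  unfolding r02_denom_smult[OF assms] using assms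
  by (intro carrier_matI) (auto simp: numeral_2_eq_2)

lemma r02_denom_index:
  assumes L: "L \<in> carrier_mat n n" and "i < n" "j < n"
  shows "r02_denom (\<gamma> \<cdot>\<^sub>m L) $$ (i,j)
    = (if i = j then 1 else 0) - \<gamma> * L $$ (i,j) + \<gamma>\<^sup>2 / 2 * (L * L) $$ (i,j)"
proof -
  have "L ^\<^sub>m 2 = L * L" using L by (simp add: numeral_2_eq_2)
  then show ?thesis unfolding r02_denom_smult[OF L] using assms by simp
qed

text \<open>\<open>Max\<close> bounds the elements of finite sets only, so finiteness of the
  spectrum has to be supplied.\<close>

lemma spectral_abscissa_ge:
  assumes A: "A \<in> carrier_mat n n" and ev: "eigenvalue (map_mat complex_of_real A) z"
  shows "Re z \<le> spectral_abscissa A"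
proof -
  have "finite (spectrum (map_mat complex_of_real A))"
    using A by (intro card_finite_spectrum(1)[of _ n]) auto
  then show ?thesis
    unfolding spectral_abscissa_def using ev by (intro Max_ge) (auto simp: spectrum_def)
qed

text \<open>The roots of \<open>1 - \<gamma>z + \<gamma>\<^sup>2z\<^sup>2/2\<close> are \<open>(1 \<plusminus> \<i>)/\<gamma>\<close>, both with positive real part.\<close>

lemma det_r02_denom_nonzero:
  assumes L: "L \<in> carrier_mat n n" and sa: "spectral_abscissa L \<le> 0" and g: "\<gamma> > 0"
  shows "det (r02_denom (\<gamma> \<cdot>\<^sub>m L)) \<noteq> 0"
proof
  assume D0: "det (r02_denom (\<gamma> \<cdot>\<^sub>m L)) = 0"
  define C where "C = map_mat complex_of_real L"
  define z1 where "z1 = (1 + \<i>) / complex_of_real \<gamma>"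
  define z2 where "z2 = (1 - \<i>) / complex_of_real \<gamma>"
  have C: "C \<in> carrier_mat n n" using L by (simp add: C_def)
  have CC: "C * C = map_mat complex_of_real (L * L)"
    unfolding C_def using L by (simp add: of_real_hom.mat_hom_mult[of _ n n])
  \<comment> \<open>Vieta's formulas for the two roots; these are the only facts about them that the
    factorization needs.\<close>
  have zz: "z1 + z2 = 2 / \<gamma>" "z1 * z2 = 2 / \<gamma>\<^sup>2"
    by (simp_all add: z1_def z2_def field_simps power2_eq_square flip: add_divide_distrib)
  define E1 where "E1 = char_matrix C z1"
  define E2 where "E2 = char_matrix C z2"
  have E: "E1 \<in> carrier_mat n n" "E2 \<in> carrier_mat n n" using C by (auto simp: E1_def E2_def)
  \<comment> \<open>The scalar factorization into linear factors carries over to matrices, since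
    only powers of \<open>C\<close> occur; \<open>char_matrix C z\<close> is \<open>C\<close> minus
    \<open>z\<close> times the identity.\<close>
  have "map_mat complex_of_real (r02_denom (\<gamma> \<cdot>\<^sub>m L)) = (complex_of_real \<gamma>^2 / 2) \<cdot>\<^sub>m (E1 * E2)"
  proof (rule eq_matI)
    fix i j assume "i < dim_row ((complex_of_real \<gamma>^2 / 2) \<cdot>\<^sub>m (E1 * E2))"
      "j < dim_col ((complex_of_real \<gamma>^2 / 2) \<cdot>\<^sub>m (E1 * E2))"
    then have ij: "i < n" "j < n" using E by auto
    have 1: "E1 $$ (i,l) = C $$ (i,l) - (if i = l then z1 else 0)" if "l < n" for l
      using C ij that by (auto simp: E1_def char_matrix_def)
    have 2: "E2 $$ (l,j) = C $$ (l,j) - (if l = j then z2 else 0)" if "l < n" for l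
      using C ij that by (auto simp: E2_def char_matrix_def)
    have "(E1 * E2) $$ (i,j) = (\<Sum>l<n. (C $$ (i,l) - (if i = l then z1 else 0)) * (C $$ (l,j) - (if l = j then z2 else 0)))"
      using index_mult_mat_sum[OF E ij] by (simp add: 1 2)
    also have "\<dots> = (\<Sum>l<n. C $$ (i,l) * C $$ (l,j) - (if l = i then z1 * C $$ (l,j) else 0)
        - (if l = j then z2 * C $$ (i,l) else 0) + (if l = i then if l = j then z1 * z2 else 0 else 0))"
      by (intro sum.cong) (auto simp: algebra_simps)
    also have "\<dots> = (C * C) $$ (i,j) - (z1 + z2) * C $$ (i,j) + (if i = j then z1 * z2 else 0)"
      using ij index_mult_mat_sum[OF C C ij]
      by (simp add: sum.distrib sum_subtractf algebra_simps del: index_mult_mat)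
    finally have EE: "(E1 * E2) $$ (i,j) = \<dots>" .
    have D: "complex_of_real (r02_denom (\<gamma> \<cdot>\<^sub>m L) $$ (i,j))
        = (if i = j then 1 else 0) - \<gamma> * C $$ (i,j) + complex_of_real \<gamma>^2 / 2 * (C * C) $$ (i,j)"
      using ij L unfolding CC r02_denom_index[OF L ij] by (simp add: C_def del: index_mult_mat(1))
    have "complex_of_real (r02_denom (\<gamma> \<cdot>\<^sub>m L) $$ (i,j)) = complex_of_real \<gamma>^2 / 2 * (E1 * E2) $$ (i,j)"
      unfolding D EE zz using g
      by (cases "i = j") (simp_all add: field_simps power2_eq_square del: index_mult_mat)
    then show "map_mat complex_of_real (r02_denom (\<gamma> \<cdot>\<^sub>m L)) $$ (i,j)
        = ((complex_of_real \<gamma>^2 / 2) \<cdot>\<^sub>m (E1 * E2)) $$ (i,j)"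
      using ij E r02_denom_carrier[OF L, of \<gamma>] by (simp del: index_mult_mat(1))
  qed (use E r02_denom_carrier[OF L, of \<gamma>] in auto)
  then have "complex_of_real (det (r02_denom (\<gamma> \<cdot>\<^sub>m L))) = (complex_of_real \<gamma>^2 / 2) ^ n * (det E1 * det E2)"
    using E by (simp add: det_mult flip: of_real_hom.hom_det)
  with D0 g have "det E1 = 0 \<or> det E2 = 0" by simp
  then have "eigenvalue C z1 \<or> eigenvalue C z2"
    by (simp add: eigenvalue_det[OF C] E1_def E2_def)
  \<comment> \<open>Both real parts are in fact \<open>1 / \<gamma>\<close>, which is
    positive.\<close>
  then have "Re z1 \<le> 0 \<or> Re z2 \<le> 0"
    using spectral_abscissa_ge[OF L] sa unfolding C_def by force
  then show False using g by (simp add: z1_def z2_def)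
qed

text \<open>A nonzero determinant makes \<open>A\<close> a unit of the matrix ring, which excludes
  the result \<open>None\<close>.\<close>

lemma mat_inverse_det_nonzero:
  fixes A :: "'a::field mat"
  assumes A: "A \<in> carrier_mat n n" and "det A \<noteq> 0"
  obtains B where "mat_inverse A = Some B" "A * B = 1\<^sub>m n" "B \<in> carrier_mat n n"
proof -
  have "A \<in> Units (ring_mat TYPE('a) n ())"
    using assms by (rule det_non_zero_imp_unit)
  then show ?thesis using mat_inverse(1)[OF A, where b = "()"] mat_inverse(2)[OF A] that
    by (cases "mat_inverse A") auto
qed

text \<open>Shows that the \<open>the\<close> in the definition of \<open>r02\<close> is applied to
  a genuine inverse for every positive \<open>\<gamma>\<close>.\<close>

lemma r02_inverse:
  assumes L: "L \<in> carrier_mat n n" and "spectral_abscissa L \<le> 0" and "\<gamma> > 0"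
  shows "mat_inverse (r02_denom (\<gamma> \<cdot>\<^sub>m L)) = Some (r02 (\<gamma> \<cdot>\<^sub>m L))"
    and "r02_denom (\<gamma> \<cdot>\<^sub>m L) * r02 (\<gamma> \<cdot>\<^sub>m L) = 1\<^sub>m n"
    and "r02 (\<gamma> \<cdot>\<^sub>m L) \<in> carrier_mat n n"
proof -
  obtain B where "mat_inverse (r02_denom (\<gamma> \<cdot>\<^sub>m L)) = Some B"
    "r02_denom (\<gamma> \<cdot>\<^sub>m L) * B = 1\<^sub>m n" "B \<in> carrier_mat n n"
    using mat_inverse_det_nonzero[OF r02_denom_carrier[OF L] det_r02_denom_nonzero[OF assms]] .
  then show "mat_inverse (r02_denom (\<gamma> \<cdot>\<^sub>m L)) = Some (r02 (\<gamma> \<cdot>\<^sub>m L))"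
    "r02_denom (\<gamma> \<cdot>\<^sub>m L) * r02 (\<gamma> \<cdot>\<^sub>m L) = 1\<^sub>m n" "r02 (\<gamma> \<cdot>\<^sub>m L) \<in> carrier_mat n n"
    by (simp_all add: r02_def)
qed

lemma r02_denom_mult_sum:
  assumes L: "L \<in> carrier_mat n n" and sa: "spectral_abscissa L \<le> 0" and g: "\<gamma> > 0"
    and ij: "i < n" "j < n"
  shows "(\<Sum>l<n. r02_denom (\<gamma> \<cdot>\<^sub>m L) $$ (i,l) * r02 (\<gamma> \<cdot>\<^sub>m L) $$ (l,j)) = (if i = j then 1 else 0)"
  using index_mult_mat_sum[OF r02_denom_carrier[OF L, of \<gamma>] r02_inverse(3)[OF L sa g] ij]
  by (simp only: r02_inverse(2)[OF L sa g]) (simp add: ij)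

section \<open>The kernel of \<open>L\<close>\<close>

text \<open>The exponential of \<open>t\<close> times \<open>L\<close> is positive, has column sums
  one and fixes \<open>x\<close>, so \<open>stochastic_fixed_vector_pos\<close> applies.\<close>

lemma kernel_vector_pos:
  assumes L: "L \<in> carrier_mat n n" and z: "zero_col_sums L" and pos: "mat_pos (mat_exp (t \<cdot>\<^sub>m L))"
    and x: "x \<in> carrier_vec n" "L *\<^sub>v x = 0\<^sub>v n" and a: "a < n" "vec_index x a > 0" and i: "i < n"
  shows "vec_index x i > 0"
proof -
  have tL: "t \<cdot>\<^sub>m L \<in> carrier_mat n n" using L by simp
  have ztL: "zero_col_sums (t \<cdot>\<^sub>m L)"
    using z by (auto simp: zero_col_sums_def simp flip: sum_distrib_left)
  have tLx: "(t \<cdot>\<^sub>m L) *\<^sub>v x = 0\<^sub>v n"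
  proof (rule eq_vecI)
    fix i assume "i < dim_vec (0\<^sub>v n :: real vec)"
    then have i: "i < n" by simp
    have "vec_index ((t \<cdot>\<^sub>m L) *\<^sub>v x) i = t * vec_index (L *\<^sub>v x) i"
      using index_mult_mat_vec_sum[OF tL x(1) i] index_mult_mat_vec_sum[OF L x(1) i] i L
      by (simp add: sum_distrib_left mult.assoc del: index_mult_mat_vec)
    then show "vec_index ((t \<cdot>\<^sub>m L) *\<^sub>v x) i = vec_index (0\<^sub>v n) i"
      using x(2) i by simp
  qed (use L in simp)
  show ?thesis
  proof (rule stochastic_fixed_vector_pos[of n "\<lambda>i j. mat_exp (t \<cdot>\<^sub>m L) $$ (i,j)"])
    show "0 < mat_exp (t \<cdot>\<^sub>m L) $$ (i,j)" if "i < n" "j < n" for i j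
      using pos L that by (auto simp: mat_pos_def mat_exp_def)
    show "(\<Sum>i<n. mat_exp (t \<cdot>\<^sub>m L) $$ (i,j)) = 1" if "j < n" for j
      using zero_col_sums_mat_exp[OF tL ztL that] .
    show "(\<Sum>j<n. mat_exp (t \<cdot>\<^sub>m L) $$ (i,j) * vec_index x j) = vec_index x i" if "i < n" for i
      using mat_exp_kernel[OF tL x(1) tLx that] .
  qed (use a i in auto)
qed

text \<open>A nonzero kernel vector has, up to sign, a positive entry; then all its entries are
  positive and cannot cancel in the sum.\<close>

lemma kernel_vector_sum_zero:
  assumes L: "L \<in> carrier_mat n n" and z: "zero_col_sums L" and pos: "mat_pos (mat_exp (t \<cdot>\<^sub>m L))"
    and x: "x \<in> carrier_vec n" "L *\<^sub>v x = 0\<^sub>v n" and s: "(\<Sum>i<n. vec_index x i) = 0"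
  shows "x = 0\<^sub>v n"
proof (rule ccontr)
  assume "x \<noteq> 0\<^sub>v n"
  then obtain a where a: "a < n" "vec_index x a \<noteq> 0" using x(1) by (auto simp: vec_eq_iff)
  define y where "y = (if vec_index x a > 0 then 1 else - 1) \<cdot>\<^sub>v x"
  have y: "y \<in> carrier_vec n" "L *\<^sub>v y = 0\<^sub>v n" "vec_index y a > 0" "(\<Sum>i<n. vec_index y i) = 0"
    using x a L s by (auto simp: y_def mult_mat_vec simp flip: sum_distrib_left)
  have "(\<Sum>i<n. vec_index y i) > 0"
    using kernel_vector_pos[OF L z pos y(1,2) a(1) y(3)] a by (intro sum_pos) auto
  then show False using y(4) by simp
qed

text \<open>The vector of ones makes the transpose of \<open>L\<close> singular, hence
  \<open>L\<close> too. A nonzero kernel vector has nonzero entry sum and can be scaled to sum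
  one.\<close>

lemma positive_kernel_vector_exists:
  assumes n: "n > 0" and L: "L \<in> carrier_mat n n" and z: "zero_col_sums L"
    and pos: "mat_pos (mat_exp (t \<cdot>\<^sub>m L))"
  obtains w where "\<And>i. i < n \<Longrightarrow> w i > 0" "(\<Sum>i<n. w i) = 1"
    "\<And>i. i < n \<Longrightarrow> (\<Sum>l<n. L $$ (i,l) * w l) = 0"
proof -
  have "transpose_mat L *\<^sub>v vec n (\<lambda>_. 1) = 0\<^sub>v n"
    using L z by (intro eq_vecI) (auto simp: scalar_prod_def zero_col_sums_def atLeast0LessThan)
  moreover have "vec n (\<lambda>_. 1) \<noteq> (0\<^sub>v n :: real vec)" using n by (auto simp: vec_eq_iff)
  ultimately have "det (transpose_mat L) = 0"
    using L by (subst det_0_iff_vec_prod_zero[of _ n]) (auto intro!: exI[of _ "vec n (\<lambda>_. 1)"])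
  then have "det L = 0" by (simp add: det_transpose[OF L])
  then obtain x where x: "x \<in> carrier_vec n" "x \<noteq> 0\<^sub>v n" "L *\<^sub>v x = 0\<^sub>v n"
    by (auto simp: det_0_iff_vec_prod_zero[OF L])
  define s where "s = (\<Sum>i<n. vec_index x i)"
  have s0: "s \<noteq> 0" using kernel_vector_sum_zero[OF L z pos x(1,3)] x(2) by (auto simp: s_def)
  define y where "y = (1 / s) \<cdot>\<^sub>v x"
  have y: "y \<in> carrier_vec n" "L *\<^sub>v y = 0\<^sub>v n" using x L by (auto simp: y_def mult_mat_vec)
  have s1: "(\<Sum>i<n. vec_index y i) = 1"
  proof -
    have "(\<Sum>i<n. vec_index y i) = (\<Sum>i<n. vec_index x i / s)"
      using x(1) by (intro sum.cong) (auto simp: y_def)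
    then show ?thesis using s0 by (simp add: s_def flip: sum_divide_distrib)
  qed
  \<comment> \<open>Entries summing to one cannot all be nonpositive.\<close>
  obtain a where a: "a < n" "vec_index y a > 0"
    using sum_nonpos[of "{..<n}" "vec_index y"] s1 by force
  show ?thesis
    using kernel_vector_pos[OF L z pos y a] s1 index_mult_mat_vec_sum[OF L y(1)] y(2)
    by (intro that[of "vec_index y"]) auto
qed

section \<open>The limit of the inverse for large \<open>\<gamma>\<close>\<close>

text \<open>\<open>w 1\<^sup>T\<close> is the spectral projection onto the kernel of \<open>L\<close>.\<close>

lemma det_square_plus_projection:
  assumes L: "L \<in> carrier_mat n n" and z: "zero_col_sums L" and pos: "mat_pos (mat_exp (t \<cdot>\<^sub>m L))"
    and w: "(\<Sum>i<n. w i) = 1"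
  shows "det (mat n n (\<lambda>(i,j). ((L * L) $$ (i,j) + w i) / 2)) \<noteq> 0" (is "det ?M \<noteq> 0")
proof
  assume "det ?M = 0"
  then obtain x where x: "x \<in> carrier_vec n" "x \<noteq> 0\<^sub>v n" "?M *\<^sub>v x = 0\<^sub>v n"
    by (auto simp: det_0_iff_vec_prod_zero[of _ n])
  define s where "s = (\<Sum>l<n. vec_index x l)"
  \<comment> \<open>Everything in the range of \<open>L\<close> has entry sum zero.\<close>
  have col: "(\<Sum>i<n. vec_index (L *\<^sub>v y) i) = 0" if "y \<in> carrier_vec n" for y
  proof -
    have "(\<Sum>i<n. vec_index (L *\<^sub>v y) i) = (\<Sum>i<n. \<Sum>l<n. L $$ (i,l) * vec_index y l)"
      using index_mult_mat_vec_sum[OF L that] by simp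
    also have "\<dots> = (\<Sum>l<n. (\<Sum>i<n. L $$ (i,l)) * vec_index y l)"
      by (subst sum.swap) (simp add: sum_distrib_right)
    also have "\<dots> = 0" using z L by (simp add: zero_col_sums_def)
    finally show ?thesis .
  qed
  have Lx: "L *\<^sub>v x \<in> carrier_vec n" using L x by simp
  have LL: "L * L \<in> carrier_mat n n" using L by simp
  have eq: "vec_index (L *\<^sub>v (L *\<^sub>v x)) i + w i * s = 0" if i: "i < n" for i
  proof -
    have "0 = 2 * vec_index (?M *\<^sub>v x) i" using x i by simp
    also have "\<dots> = (\<Sum>l<n. ((L * L) $$ (i,l) + w i) * vec_index x l)"
      using i x by (subst index_mult_mat_vec_sum[of _ n]) (auto simp: sum_distrib_left simp del: index_mult_mat)
    also have "\<dots> = vec_index (L * L *\<^sub>v x) i + w i * s"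
      by (simp add: index_mult_mat_vec_sum[OF LL x(1) i] s_def algebra_simps sum.distrib sum_distrib_left
          del: index_mult_mat)
    finally show ?thesis using L x by (simp add: assoc_mult_mat_vec[of _ n n])
  qed
  \<comment> \<open>Summing over all entries removes the part in the range of \<open>L\<close> and
    isolates \<open>s\<close>.\<close>
  have "0 = (\<Sum>i<n. vec_index (L *\<^sub>v (L *\<^sub>v x)) i + w i * s)" using eq by simp
  also have "\<dots> = s"
    by (simp add: sum.distrib col[OF Lx] w flip: sum_distrib_right)
  finally have s: "s = 0" by simp
  then have "L *\<^sub>v (L *\<^sub>v x) = 0\<^sub>v n"
    using eq L by (intro eq_vecI) auto
  \<comment> \<open>\<open>L *\<^sub>v x\<close> lies in the kernel and in the range of
    \<open>L\<close>, so it is a kernel vector of entry sum zero. With \<open>s = 0\<close>, the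
    same lemma then applies to \<open>x\<close>.\<close>
  then have "L *\<^sub>v x = 0\<^sub>v n"
    using kernel_vector_sum_zero[OF L z pos Lx] col[OF x(1)] by blast
  then show False
    using kernel_vector_sum_zero[OF L z pos x(1)] x(2) s by (simp add: s_def)
qed

text \<open>The limit matrix has all columns equal to \<open>w\<close>, so the limit does not depend
  on \<open>j\<close>. Division by \<open>\<gamma>\<^sup>2\<close> alone would leave the singular
  limit \<open>L * L\<close> over 2; adding a multiple of the projection repairs this.\<close>

lemma r02_tendsto_projection:
  assumes L: "L \<in> carrier_mat n n" and z: "zero_col_sums L" and sa: "spectral_abscissa L \<le> 0"
    and pos: "mat_pos (mat_exp (t \<cdot>\<^sub>m L))"
    and w: "(\<Sum>i<n. w i) = 1" and Lw: "\<And>i. i < n \<Longrightarrow> (\<Sum>l<n. L $$ (i,l) * w l) = 0"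
    and ij: "i < n" "j < n"
  shows "((\<lambda>\<gamma>. r02 (\<gamma> \<cdot>\<^sub>m L) $$ (i,j)) \<longlongrightarrow> w i) at_top"
proof -
  let ?D = "\<lambda>\<gamma>. r02_denom (\<gamma> \<cdot>\<^sub>m L)" and ?R = "\<lambda>\<gamma>. r02 (\<gamma> \<cdot>\<^sub>m L)"
  \<comment> \<open>The projection annihilates the difference \<open>X \<gamma>\<close> from the
    left for positive \<open>\<gamma>\<close>, so its coefficient does not affect the product in
    \<open>AX\<close>; what matters is that it tends to 1/2.\<close>
  define A where "A \<gamma> = mat n n (\<lambda>(i,j). ?D \<gamma> $$ (i,j) / \<gamma>\<^sup>2 + (1/2 - 1/\<gamma>) * w i)" for \<gamma>
  define A0 where "A0 = mat n n (\<lambda>(i,j). ((L * L) $$ (i,j) + w i) / 2)"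
  \<comment> \<open>Rebuilding with \<open>mat n n\<close> fixes the dimensions for all real
    \<open>\<gamma>\<close>, including those where invertibility of the denominator is not
    established.\<close>
  define X where "X \<gamma> = mat n n (\<lambda>(i,j). ?R \<gamma> $$ (i,j) - w i)" for \<gamma>
  have carr: "A \<gamma> \<in> carrier_mat n n" "A0 \<in> carrier_mat n n" "X \<gamma> \<in> carrier_mat n n" for \<gamma>
    by (simp_all add: A_def A0_def X_def)
  have LLw: "(\<Sum>l<n. (L * L) $$ (i,l) * w l) = 0" if "i < n" for i
  proof -
    have "(\<Sum>l<n. (L * L) $$ (i,l) * w l) = (\<Sum>l<n. \<Sum>k<n. L $$ (i,k) * L $$ (k,l) * w l)"
      using index_mult_mat_sum[OF L L that] by (simp add: sum_distrib_right del: index_mult_mat)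
    also have "\<dots> = (\<Sum>k<n. L $$ (i,k) * (\<Sum>l<n. L $$ (k,l) * w l))"
      by (subst sum.swap) (simp add: sum_distrib_left mult.assoc)
    finally show ?thesis using Lw by simp
  qed
  have colL: "(\<Sum>i<n. L $$ (i,j)) = 0" if "j < n" for j
    using z L that by (simp add: zero_col_sums_def)
  have colLL: "(\<Sum>i<n. (L * L) $$ (i,j)) = 0" if "j < n" for j
    using zero_col_sums_pow[OF L z that, of 2] L by (simp add: numeral_2_eq_2)
  \<comment> \<open>Only the identity term of the denominator acts on the kernel vector
    \<open>w\<close>; \<open>colD\<close> is the dual fact for the row vector of ones.\<close>
  have Dw: "(\<Sum>l<n. ?D \<gamma> $$ (i,l) * w l) = w i" if "i < n" for i \<gamma>
  proof -
    have "(\<Sum>l<n. ?D \<gamma> $$ (i,l) * w l) = (\<Sum>l<n. (if l = i then w l else 0)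
        - \<gamma> * (L $$ (i,l) * w l) + \<gamma>\<^sup>2 / 2 * ((L * L) $$ (i,l) * w l))"
      using that by (intro sum.cong) (auto simp: r02_denom_index[OF L] algebra_simps simp del: index_mult_mat)
    also have "\<dots> = w i"
      using that
      by (simp only: sum.distrib sum_subtractf flip: sum_distrib_left) (simp add: Lw LLw del: index_mult_mat)
    finally show ?thesis .
  qed
  have colD: "(\<Sum>i<n. ?D \<gamma> $$ (i,l)) = 1" if "l < n" for l \<gamma>
    using that
    by (simp add: r02_denom_index[OF L] del: index_mult_mat times_divide_eq_left)
      (simp only: sum.distrib sum_subtractf flip: sum_distrib_left,
        simp add: colL colLL del: index_mult_mat)
  have DR: "(\<Sum>l<n. ?D \<gamma> $$ (i,l) * ?R \<gamma> $$ (l,j)) = (if i = j then 1 else 0)"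
    if "i < n" "j < n" "\<gamma> > 0" for i j \<gamma>
    by (rule r02_denom_mult_sum[OF L sa that(3,1,2)])
  \<comment> \<open>The denominator preserves column sums, hence so does its inverse.\<close>
  have colR: "(\<Sum>l<n. ?R \<gamma> $$ (l,j)) = 1" if "j < n" "\<gamma> > 0" for j \<gamma>
  proof -
    have "1 = (\<Sum>i<n. \<Sum>l<n. ?D \<gamma> $$ (i,l) * ?R \<gamma> $$ (l,j))"
      using that by (simp add: DR)
    also have "\<dots> = (\<Sum>l<n. (\<Sum>i<n. ?D \<gamma> $$ (i,l)) * ?R \<gamma> $$ (l,j))"
      by (subst sum.swap) (simp add: sum_distrib_right)
    finally show ?thesis by (simp add: colD)
  qed
  have AX: "(A \<gamma> * X \<gamma>) $$ (i,j) = ((if i = j then 1 else 0) - w i) / \<gamma>\<^sup>2"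
    if "i < n" "j < n" "\<gamma> > 0" for i j \<gamma>
  proof -
    have "(A \<gamma> * X \<gamma>) $$ (i,j)
        = (\<Sum>l<n. (?D \<gamma> $$ (i,l) / \<gamma>\<^sup>2 + (1/2 - 1/\<gamma>) * w i) * (?R \<gamma> $$ (l,j) - w l))"
      using index_mult_mat_sum[OF carr(1,3) that(1,2)] that by (simp add: A_def X_def del: index_mult_mat)
    also have "\<dots> = (\<Sum>l<n. 1 / \<gamma>\<^sup>2 * (?D \<gamma> $$ (i,l) * ?R \<gamma> $$ (l,j))
         - 1 / \<gamma>\<^sup>2 * (?D \<gamma> $$ (i,l) * w l) + (1/2 - 1/\<gamma>) * w i * ?R \<gamma> $$ (l,j)
         - (1/2 - 1/\<gamma>) * w i * w l)"
      by (intro sum.cong) (simp_all add: ring_distribs diff_divide_distrib)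
    also have "\<dots> = 1 / \<gamma>\<^sup>2 * (if i = j then 1 else 0) - 1 / \<gamma>\<^sup>2 * w i"
      using that
      by (simp only: sum.distrib sum_subtractf flip: sum_distrib_left) (simp add: DR Dw colR w)
    finally show ?thesis by (simp add: diff_divide_distrib)
  qed
  have limA: "((\<lambda>\<gamma>. A \<gamma> $$ (i,j)) \<longlongrightarrow> A0 $$ (i,j)) at_top" if "i < n" "j < n" for i j
  proof -
    define d where "d = (if i = j then 1 else 0 :: real)"
    \<comment> \<open>Rewritten in powers of \<open>1/\<gamma>\<close>, which tends to zero.\<close>
    have "((\<lambda>\<gamma>. d * (1/\<gamma>)^2 - L $$ (i,j) * (1/\<gamma>) + (L * L) $$ (i,j) / 2 + (1/2 - 1/\<gamma>) * w i)
        \<longlongrightarrow> d * 0^2 - L $$ (i,j) * 0 + (L * L) $$ (i,j) / 2 + (1/2 - 0) * w i) at_top"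
      by (intro tendsto_intros tendsto_divide_0[OF tendsto_const] filterlim_at_top_imp_at_infinity filterlim_ident)
    also have "d * 0^2 - L $$ (i,j) * 0 + (L * L) $$ (i,j) / 2 + (1/2 - 0) * w i = A0 $$ (i,j)"
      using that by (simp add: A0_def add_divide_distrib del: index_mult_mat)
    finally show ?thesis
    proof (rule Lim_transform_eventually)
      show "\<forall>\<^sub>F \<gamma> in at_top. d * (1/\<gamma>)^2 - L $$ (i,j) * (1/\<gamma>) + (L * L) $$ (i,j) / 2 + (1/2 - 1/\<gamma>) * w i
          = A \<gamma> $$ (i,j)"
        using eventually_gt_at_top[of 0]
      proof eventually_elim
        case (elim \<gamma>)
        have "A \<gamma> $$ (i,j) = (d - \<gamma> * L $$ (i,j) + \<gamma>\<^sup>2 / 2 * (L * L) $$ (i,j)) / \<gamma>\<^sup>2 + (1/2 - 1/\<gamma>) * w i"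
          using that by (simp add: A_def r02_denom_index[OF L] d_def del: index_mult_mat)
        then show ?case
          using elim by (simp add: field_simps power2_eq_square del: index_mult_mat)
      qed
    qed
  qed
  have limC: "((\<lambda>\<gamma>. (A \<gamma> * X \<gamma>) $$ (i,j)) \<longlongrightarrow> (A0 * 0\<^sub>m n n) $$ (i,j)) at_top" if "i < n" "j < n" for i j
  proof (rule Lim_transform_eventually)
    have "((\<lambda>\<gamma>. ((if i = j then 1 else 0) - w i) * (1/\<gamma>)^2) \<longlongrightarrow> ((if i = j then 1 else 0) - w i) * 0^2) at_top"
      by (intro tendsto_intros tendsto_divide_0[OF tendsto_const] filterlim_at_top_imp_at_infinity filterlim_ident)
    then show "((\<lambda>\<gamma>. ((if i = j then 1 else 0) - w i) * (1/\<gamma>)^2) \<longlongrightarrow> (A0 * 0\<^sub>m n n) $$ (i,j)) at_top"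
      using that carr(2) by (simp add: right_mult_zero_mat[of A0 n n] del: index_mult_mat)
    show "\<forall>\<^sub>F \<gamma> in at_top. ((if i = j then 1 else 0) - w i) * (1/\<gamma>)^2 = (A \<gamma> * X \<gamma>) $$ (i,j)"
      using eventually_gt_at_top[of 0]
      by eventually_elim (simp add: AX[OF that] power_divide del: index_mult_mat)
  qed
  have "((\<lambda>\<gamma>. X \<gamma> $$ (i,j)) \<longlongrightarrow> 0\<^sub>m n n $$ (i,j)) at_top"
    using det_square_plus_projection[OF L z pos w]
    by (intro tendsto_mat_solution[OF carr(1,2,3) _ limA limC _ ij]) (auto simp: A0_def)
  then have "((\<lambda>\<gamma>. X \<gamma> $$ (i,j) + w i) \<longlongrightarrow> 0 + w i) at_top"
    using ij by (intro tendsto_intros) auto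
  then show ?thesis using ij by (simp add: X_def)
qed

section \<open>The behaviour of the inverse for small positive \<open>\<gamma>\<close>\<close>

text \<open>The denominator tends to the identity and its product with the inverse is constantly the
  identity, so \<open>tendsto_mat_solution\<close> applies.\<close>

lemma r02_tendsto_one:
  assumes L: "L \<in> carrier_mat n n" and sa: "spectral_abscissa L \<le> 0" and ij: "i < n" "j < n"
  shows "((\<lambda>\<gamma>. r02 (\<gamma> \<cdot>\<^sub>m L) $$ (i,j)) \<longlongrightarrow> 1\<^sub>m n $$ (i,j)) (at_right 0)"
proof -
  define X where "X \<gamma> = mat n n (\<lambda>(i,j). r02 (\<gamma> \<cdot>\<^sub>m L) $$ (i,j))" for \<gamma>
  have X: "X \<gamma> \<in> carrier_mat n n" for \<gamma> by (simp add: X_def)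
  have XR: "X \<gamma> = r02 (\<gamma> \<cdot>\<^sub>m L)" if "\<gamma> > 0" for \<gamma>
    using r02_inverse(3)[OF L sa that] by (auto simp: X_def intro!: eq_matI)
  have limA: "((\<lambda>\<gamma>. r02_denom (\<gamma> \<cdot>\<^sub>m L) $$ (i,j)) \<longlongrightarrow> 1\<^sub>m n $$ (i,j)) (at_right 0)"
    if "i < n" "j < n" for i j
    unfolding r02_denom_index[OF L that] using that
    by (auto simp del: index_mult_mat intro!: tendsto_eq_intros)
  have limC: "((\<lambda>\<gamma>. (r02_denom (\<gamma> \<cdot>\<^sub>m L) * X \<gamma>) $$ (i,j)) \<longlongrightarrow> (1\<^sub>m n * 1\<^sub>m n) $$ (i,j)) (at_right 0)"
    if "i < n" "j < n" for i j
  proof (rule tendsto_eventually)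
    show "\<forall>\<^sub>F \<gamma> in at_right 0. (r02_denom (\<gamma> \<cdot>\<^sub>m L) * X \<gamma>) $$ (i,j) = (1\<^sub>m n * 1\<^sub>m n) $$ (i,j)"
      using eventually_at_right_less[of 0]
      by eventually_elim (simp add: XR r02_inverse(2)[OF L sa] left_mult_one_mat[of _ n n] del: index_mult_mat)
  qed
  have "((\<lambda>\<gamma>. X \<gamma> $$ (i,j)) \<longlongrightarrow> 1\<^sub>m n $$ (i,j)) (at_right 0)"
    by (rule tendsto_mat_solution[OF r02_denom_carrier[OF L] _ X _ limA limC _ ij]) auto
  then show ?thesis using ij by (simp add: X_def)
qed

text \<open>Off the diagonal the identity drops out of the equation for the inverse; the rest
  carries a factor \<open>\<gamma>\<close>, and \<open>r02_tendsto_one\<close> gives the limit of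
  the quotient.\<close>

lemma r02_offdiag_derivative:
  assumes L: "L \<in> carrier_mat n n" and sa: "spectral_abscissa L \<le> 0"
    and ij: "i < n" "j < n" "i \<noteq> j"
  shows "((\<lambda>\<gamma>. r02 (\<gamma> \<cdot>\<^sub>m L) $$ (i,j) / \<gamma>) \<longlongrightarrow> L $$ (i,j)) (at_right 0)"
proof (rule Lim_transform_eventually)
  let ?R = "\<lambda>\<gamma>. r02 (\<gamma> \<cdot>\<^sub>m L)"
  have "((\<lambda>\<gamma>. \<Sum>l<n. (L $$ (i,l) - \<gamma> / 2 * (L * L) $$ (i,l)) * ?R \<gamma> $$ (l,j))
      \<longlongrightarrow> (\<Sum>l<n. (L $$ (i,l) - 0 / 2 * (L * L) $$ (i,l)) * 1\<^sub>m n $$ (l,j))) (at_right 0)"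
    using ij by (intro tendsto_intros r02_tendsto_one[OF L sa]) auto
  also have "(\<Sum>l<n. (L $$ (i,l) - 0 / 2 * (L * L) $$ (i,l)) * 1\<^sub>m n $$ (l,j))
      = (\<Sum>l<n. if l = j then L $$ (i,l) else 0)"
    using ij by (intro sum.cong) (auto simp del: index_mult_mat)
  also have "\<dots> = L $$ (i,j)" using ij by simp
  finally show "((\<lambda>\<gamma>. \<Sum>l<n. (L $$ (i,l) - \<gamma> / 2 * (L * L) $$ (i,l)) * ?R \<gamma> $$ (l,j)) \<longlongrightarrow> L $$ (i,j)) (at_right 0)" .
  have eq: "(\<Sum>l<n. (L $$ (i,l) - \<gamma> / 2 * (L * L) $$ (i,l)) * ?R \<gamma> $$ (l,j)) = ?R \<gamma> $$ (i,j) / \<gamma>"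
    if g: "\<gamma> > 0" for \<gamma>
  proof -
    have "0 = (\<Sum>l<n. r02_denom (\<gamma> \<cdot>\<^sub>m L) $$ (i,l) * ?R \<gamma> $$ (l,j))"
      using r02_denom_mult_sum[OF L sa g ij(1,2)] ij(3) by simp
    \<comment> \<open>Splits the denominator into the identity and a remainder divisible by
      \<open>\<gamma>\<close>.\<close>
    also have "\<dots> = (\<Sum>l<n. (if l = i then ?R \<gamma> $$ (l,j) else 0)
        - \<gamma> * ((L $$ (i,l) - \<gamma> / 2 * (L * L) $$ (i,l)) * ?R \<gamma> $$ (l,j)))"
      using ij by (intro sum.cong)
        (auto simp: r02_denom_index[OF L] algebra_simps power2_eq_square simp del: index_mult_mat)
    also have "\<dots> = ?R \<gamma> $$ (i,j) - \<gamma> * (\<Sum>l<n. (L $$ (i,l) - \<gamma> / 2 * (L * L) $$ (i,l)) * ?R \<gamma> $$ (l,j))"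
      using ij by (simp add: sum_subtractf sum_distrib_left del: index_mult_mat)
    finally show ?thesis using g by (simp add: field_simps del: index_mult_mat)
  qed
  show "\<forall>\<^sub>F \<gamma> in at_right 0. (\<Sum>l<n. (L $$ (i,l) - \<gamma> / 2 * (L * L) $$ (i,l)) * ?R \<gamma> $$ (l,j)) = ?R \<gamma> $$ (i,j) / \<gamma>"
    using eventually_at_right_less[of 0] by eventually_elim (rule eq)
qed

theorem theorem4:
  fixes L :: "real mat" and n :: nat
  assumes "n > 0"
    and "L \<in> carrier_mat n n"
    and "irreducible_mat L"
    and "zero_col_sums L"
    and "spectral_abscissa L = 0"
    and "simple_eigenvalue (map_mat complex_of_real L) 0"
    and "eventually_exp_pos L"
  shows "(\<exists>\<gamma>\<^sub>r\<ge>0. r02_pos_from L \<gamma>\<^sub>r) \<and>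
    ((\<exists>i<n. \<exists>j<n. i \<noteq> j \<and> L $$ (i,j) < 0) \<longrightarrow>
      (\<exists>\<gamma>\<^sub>0>0. \<forall>\<gamma>. 0 < \<gamma> \<and> \<gamma> < \<gamma>\<^sub>0 \<longrightarrow>
         mat_inverse (r02_denom (\<gamma> \<cdot>\<^sub>m L)) = Some (r02 (\<gamma> \<cdot>\<^sub>m L)) \<and>
         mat_has_neg_entry (r02 (\<gamma> \<cdot>\<^sub>m L))) \<and>
      (\<forall>\<gamma>\<^sub>r\<ge>0. r02_pos_from L \<gamma>\<^sub>r \<longrightarrow> \<gamma>\<^sub>r > 0))"
proof -
  note n = assms(1) and L = assms(2) and z = assms(4)
  have sa: "spectral_abscissa L \<le> 0" using assms(5) by simp
  obtain t where pos: "mat_pos (mat_exp (t \<cdot>\<^sub>m L))"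
    using assms(7) by (auto simp: eventually_exp_pos_def)
  obtain w where w: "\<And>i. i < n \<Longrightarrow> w i > 0" "(\<Sum>i<n. w i) = 1"
    "\<And>i. i < n \<Longrightarrow> (\<Sum>l<n. L $$ (i,l) * w l) = 0"
    using positive_kernel_vector_exists[OF n L z pos] by blast
  have carr: "dim_row (r02 (\<gamma> \<cdot>\<^sub>m L)) = n" "dim_col (r02 (\<gamma> \<cdot>\<^sub>m L)) = n" if "\<gamma> > 0" for \<gamma>
    using r02_inverse(3)[OF L sa that] by auto
  \<comment> \<open>Each of the finitely many entries has a positive limit, so one threshold serves
    all of them.\<close>
  have "\<forall>\<^sub>F \<gamma> in at_top. \<forall>i\<in>{..<n}. \<forall>j\<in>{..<n}. 0 < r02 (\<gamma> \<cdot>\<^sub>m L) $$ (i,j)"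
    by (intro eventually_ball_finite ballI finite_lessThan
        order_tendstoD(1)[OF r02_tendsto_projection[OF L z sa pos w(2,3)]]) (auto intro: w(1))
  then obtain g where g: "\<And>\<gamma> i j. \<gamma> \<ge> g \<Longrightarrow> i < n \<Longrightarrow> j < n \<Longrightarrow> 0 < r02 (\<gamma> \<cdot>\<^sub>m L) $$ (i,j)"
    by (auto simp: eventually_at_top_linorder)
  \<comment> \<open>The maximum only secures a nonnegative threshold.\<close>
  have 1: "r02_pos_from L (max 0 g)"
    using r02_inverse(1)[OF L sa] L g carr
    by (auto simp: r02_pos_from_def mat_pos_def r02_denom_smult[OF L])
  have 2: "\<exists>\<gamma>\<^sub>0>0. \<forall>\<gamma>. 0 < \<gamma> \<and> \<gamma> < \<gamma>\<^sub>0 \<longrightarrow> mat_has_neg_entry (r02 (\<gamma> \<cdot>\<^sub>m L))"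
    if neg: "\<exists>i<n. \<exists>j<n. i \<noteq> j \<and> L $$ (i,j) < 0"
  proof -
    obtain i j where ij: "i < n" "j < n" "i \<noteq> j" "L $$ (i,j) < 0" using neg by blast
    \<comment> \<open>The negative entry of the inverse sits where \<open>L\<close> has its negative
      off-diagonal entry.\<close>
    have "\<forall>\<^sub>F \<gamma> in at_right 0. r02 (\<gamma> \<cdot>\<^sub>m L) $$ (i,j) / \<gamma> < 0"
      using r02_offdiag_derivative[OF L sa ij(1-3)] ij(4) by (rule order_tendstoD(2))
    then obtain b where b: "b > 0" "\<And>\<gamma>. 0 < \<gamma> \<Longrightarrow> \<gamma> < b \<Longrightarrow> r02 (\<gamma> \<cdot>\<^sub>m L) $$ (i,j) / \<gamma> < 0"
      by (auto simp: eventually_at_right_field)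
    have "mat_has_neg_entry (r02 (\<gamma> \<cdot>\<^sub>m L))" if "0 < \<gamma>" "\<gamma> < b" for \<gamma>
      unfolding mat_has_neg_entry_def carr[OF that(1)]
      using b(2)[OF that] that(1) ij by (auto simp: divide_less_0_iff)
    then show ?thesis using b(1) by blast
  qed
  have 3: "\<gamma>\<^sub>r > 0" if neg: "\<exists>i<n. \<exists>j<n. i \<noteq> j \<and> L $$ (i,j) < 0"
    and r: "\<gamma>\<^sub>r \<ge> 0" "r02_pos_from L \<gamma>\<^sub>r" for \<gamma>\<^sub>r
  proof (rule ccontr)
    assume "\<not> \<gamma>\<^sub>r > 0"
    then have allpos: "mat_pos (r02 (\<gamma> \<cdot>\<^sub>m L))" if "\<gamma> > 0" for \<gamma>
      using r that by (auto simp: r02_pos_from_def)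
    obtain b where b: "b > 0" "\<And>\<gamma>. 0 < \<gamma> \<Longrightarrow> \<gamma> < b \<Longrightarrow> mat_has_neg_entry (r02 (\<gamma> \<cdot>\<^sub>m L))"
      using 2[OF neg] by blast
    \<comment> \<open>Any point strictly between 0 and \<open>b\<close> would do: a threshold of
      zero demands positivity there as well.\<close>
    have "mat_has_neg_entry (r02 ((b/2) \<cdot>\<^sub>m L))" "mat_pos (r02 ((b/2) \<cdot>\<^sub>m L))"
      using b allpos by auto
    then show False by (force simp: mat_has_neg_entry_def mat_pos_def)
  qed
  show ?thesis
    using 1 2 3 r02_inverse(1)[OF L sa] by (meson max.cobounded1)
qed

end
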